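(* Let $\Omega$ and $J_\varepsilon$ be as in either the general setting or the periodic setting described in the context. Assume that $f\in C^1(\mathbb{R})$ with $f'\in L^\infty(\mathbb{R})$, and that there exist $u_1<u_2$ with $f(u_1)=f(u_2)=0$. Let $u\in C([0,\infty),L^2(\Omega))$ be a solution of the initial value problem $$u_t(x,t)=\mathcal{L}_\varepsilon u(x,t)+f(u(x,t)),\quad (x,t)\in\Omega\times(0,\infty),\qquad u(x,0)=u_0(x),\quad x\in\Omega,$$ with initial datum $u_0\in L^2(\Omega)$. Denote $\Gamma=[u_1,u_2]$. If $u_0(x)\in\Gamma$ for a.e. $x\in\Omega$, then $u(x,t)\in\Gamma$ for a.e. $x\in\Omega$, for all $t>0$.
   Context: The dispersion operator $\mathcal{L}_\varepsilon:L^2(\Omega)\to L^2(\Omega)$ is $\mathcal{L}_\varepsilon u(x)=\int_\Omega J_\varepsilon(x-y)\left(u(y)-u(x)\right)dy$. A solution of the initial value problem is a function $u$ satisfying $u(x,t)=u_0(x)+\int_0^t\mathcal{L}_\varepsilon u(x,s)\,ds+\int_0^t f(u(x,s))\,ds$. General setting: $\Omega\subset\mathbb{R}^n$ is open and bounded. The kernel $J\in C(\mathbb{R}^n)$ satisfies: $J(z)\ge 0$ for all $z\in\mathbb{R}^n$ and $J(0)>0$; $J(z)=J(-z)$ for all $z$; $J(z)\to 0$ as $|z|\to\infty$; $\int_{\mathbb{R}^n}J(z)|z|^2\,dz<\infty$; $\int_{\mathbb{R}^n}J(z)\,dz=1$. For $\varepsilon>0$ and $m\in[0,2]$, $J_\varepsilon(z)=\frac{C_{norm}}{\varepsilon^{m+n}}J\left(\frac{z}{\varepsilon}\right)$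 with $C_{norm}=\left(\frac12\int_{\mathbb{R}^n}J(z)|z|^2\,dz\right)^{-1}$. Periodic setting: $\Omega=\mathbb{T}^n=(-\pi,\pi)^n$ is the $n$-dimensional torus. The kernel $J\in C(\mathbb{R}^n)$ satisfies: $J\ge0$ and $J(0)>0$; $J(z)=J(-z)$; $J(z)\to0$ as $|z|\to\infty$. For $\varepsilon>0$ and $m\in[0,2]$, $J_{per}$ denotes $J$ truncated to $\left(-\frac{\pi}{\varepsilon},\frac{\pi}{\varepsilon}\right)^n$ and extended $\frac{2\pi}{\varepsilon}$-periodically in each coordinate, and $J_\varepsilon(z)=\frac{C_{norm}^\varepsilon}{\varepsilon^{m+n}}J_{per}\left(\frac{z}{\varepsilon}\right)$ with $C_{norm}^\varepsilon=\left(\frac12\int_{(-\frac{\pi}{\varepsilon},\frac{\pi}{\varepsilon})^n}J_{per}(z)|z|^2\,dz\right)^{-1}$; $J_\varepsilon$ is $2\pi$-periodic and belongs to $C(\mathbb{T}^n)$. *)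

theory Defs
  imports "HOL-Analysis.Analysis"
begin

text \<open>The space $L^2(\Omega)$ is represented by functions, not by equivalence classes; all notions
  below are invariant under changes on null sets.\<close>

definition L2 :: "(real^'n) set \<Rightarrow> (real^'n \<Rightarrow> real) set" where
  "L2 \<Omega> = {v. v \<in> borel_measurable (lebesgue_on \<Omega>) \<and>
              integrable (lebesgue_on \<Omega>) (\<lambda>x. (v x)\<^sup>2)}"

definition L2_norm :: "(real^'n) set \<Rightarrow> (real^'n \<Rightarrow> real) \<Rightarrow> real" where
  "L2_norm \<Omega> v = sqrt (\<integral>x. (v x)\<^sup>2 \<partial>lebesgue_on \<Omega>)"

definition C_L2 :: "(real^'n) set \<Rightarrow> (real \<Rightarrow> real^'n \<Rightarrow> real) set" where
  "C_L2 \<Omega> = {u. (\<forall>t\<ge>0. u t \<in> L2 \<Omega>) \<and>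
     (\<forall>t\<ge>0. ((\<lambda>s. L2_norm \<Omega> (\<lambda>x. u s x - u t x)) \<longlongrightarrow> 0) (at t within {0..}))}"

text \<open>Integral over $[a,b]$ of an $L^2(\Omega)$-valued function of time, as an element of
  $L^2(\Omega)$: this is the gauge characterization of \<^const>\<open>has_integral\<close> with the $L^2(\Omega)$ norm. For
  integrands continuous into $L^2(\Omega)$ it is the usual Riemann (equivalently Bochner) integral.
  Membership of the integrand in $L^2(\Omega)$ has to be required explicitly, since
  \<^const>\<open>L2_norm\<close> is 0 on functions that are not square integrable.\<close>

definition L2_has_integral ::
    "(real^'n) set \<Rightarrow> (real \<Rightarrow> real^'n \<Rightarrow> real) \<Rightarrow> (real^'n \<Rightarrow> real) \<Rightarrow> real \<Rightarrow> real \<Rightarrow> bool" where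
  "L2_has_integral \<Omega> v I a b \<longleftrightarrow>
     (\<forall>s\<in>{a..b}. v s \<in> L2 \<Omega>) \<and> I \<in> L2 \<Omega> \<and>
     (\<forall>e>0. \<exists>\<gamma>. gauge \<gamma> \<and>
        (\<forall>\<D>. \<D> tagged_division_of {a..b} \<and> \<gamma> fine \<D> \<longrightarrow>
           L2_norm \<Omega> (\<lambda>x. (\<Sum>(s, K)\<in>\<D>. measure lborel K * v s x) - I x) < e))"

definition dispersion ::
    "(real^'n) set \<Rightarrow> (real^'n \<Rightarrow> real) \<Rightarrow> (real^'n \<Rightarrow> real) \<Rightarrow> real^'n \<Rightarrow> real" where
  "dispersion \<Omega> K v x = (\<integral>y. K (x - y) * (v y - v x) \<partial>lebesgue_on \<Omega>)"

definition is_solution ::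
    "(real^'n) set \<Rightarrow> (real^'n \<Rightarrow> real) \<Rightarrow> (real \<Rightarrow> real) \<Rightarrow> (real^'n \<Rightarrow> real) \<Rightarrow>
     (real \<Rightarrow> real^'n \<Rightarrow> real) \<Rightarrow> bool" where
  "is_solution \<Omega> K f u0 u \<longleftrightarrow>
     (\<forall>t\<ge>0. \<exists>A B.
        L2_has_integral \<Omega> (\<lambda>s. dispersion \<Omega> K (u s)) A 0 t \<and>
        L2_has_integral \<Omega> (\<lambda>s x. f (u s x)) B 0 t \<and>
        (AE x in lebesgue_on \<Omega>. u t x = u0 x + A x + B x))"

definition dispersal_kernel :: "(real^'n \<Rightarrow> real) \<Rightarrow> bool" where
  "dispersal_kernel J \<longleftrightarrow> continuous_on UNIV J \<and> (\<forall>z. 0 \<le> J z) \<and> 0 < J 0 \<and>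
     (\<forall>z. J z = J (- z)) \<and> (J \<longlongrightarrow> 0) at_infinity"

definition normalized_kernel :: "(real^'n \<Rightarrow> real) \<Rightarrow> bool" where
  "normalized_kernel J \<longleftrightarrow> dispersal_kernel J \<and>
     integrable lebesgue (\<lambda>z. J z * (norm z)\<^sup>2) \<and>
     integrable lebesgue J \<and> (\<integral>z. J z \<partial>lebesgue) = 1"

definition C_norm :: "(real^'n \<Rightarrow> real) \<Rightarrow> real" where
  "C_norm J = inverse (1/2 * (\<integral>z. J z * (norm z)\<^sup>2 \<partial>lebesgue))"

definition J_eps :: "real \<Rightarrow> real \<Rightarrow> (real^'n \<Rightarrow> real) \<Rightarrow> real^'n \<Rightarrow> real" where
  "J_eps \<epsilon> m J z = C_norm J / \<epsilon> powr (m + real CARD('n)) * J (z /\<^sub>R \<epsilon>)"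

definition cube :: "real \<Rightarrow> (real^'n) set" where
  "cube r = {x. \<forall>i. - r < x $ i \<and> x $ i < r}"

text \<open>Each coordinate is shifted by a multiple of $2\pi/\varepsilon$ into
  $[-\pi/\varepsilon,\pi/\varepsilon)$. Including the left end point only fixes the values on the
  faces of the cube, a null set.\<close>

definition J_per :: "real \<Rightarrow> (real^'n \<Rightarrow> real) \<Rightarrow> real^'n \<Rightarrow> real" where
  "J_per \<epsilon> J z =
     J (\<chi> i. z $ i - (2 * pi / \<epsilon>) * real_of_int \<lfloor>(z $ i + pi / \<epsilon>) / (2 * pi / \<epsilon>)\<rfloor>)"

definition C_norm_per :: "real \<Rightarrow> (real^'n \<Rightarrow> real) \<Rightarrow> real" where
  "C_norm_per \<epsilon> J =
     inverse (1/2 * (\<integral>z. J_per \<epsilon> J z * (norm z)\<^sup>2 \<partial>lebesgue_on (cube (pi / \<epsilon>))))"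

definition J_eps_per :: "real \<Rightarrow> real \<Rightarrow> (real^'n \<Rightarrow> real) \<Rightarrow> real^'n \<Rightarrow> real" where
  "J_eps_per \<epsilon> m J z =
     C_norm_per \<epsilon> J / \<epsilon> powr (m + real CARD('n)) * J_per \<epsilon> J (z /\<^sub>R \<epsilon>)"

lemma J_per_eq:
  fixes z :: "real^'n"
  assumes "0 < \<epsilon>" "z \<in> cube (pi / \<epsilon>)"
  shows "J_per \<epsilon> J z = J z"
proof -
  have "\<lfloor>(z $ i + pi / \<epsilon>) / (2 * pi / \<epsilon>)\<rfloor> = 0" for i
  proof -
    have "- (pi / \<epsilon>) < z $ i" "z $ i < pi / \<epsilon>"
      using assms(2) by (auto simp: cube_def)
    then have p: "0 \<le> z $ i + pi / \<epsilon>" "z $ i + pi / \<epsilon> < 2 * pi / \<epsilon>"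
      by linarith+
    have "0 \<le> (z $ i + pi / \<epsilon>) / (2 * pi / \<epsilon>)"
      by (rule divide_nonneg_nonneg) (use p(1) assms(1) in auto)
    moreover have "(z $ i + pi / \<epsilon>) / (2 * pi / \<epsilon>) < 1"
      using p by (subst divide_less_eq_1_pos) linarith+
    ultimately show ?thesis
      by (simp only: floor_eq_iff) simp
  qed
  then show ?thesis
    by (simp add: J_per_def)
qed

lemma J_per_periodic:
  fixes z :: "real^'n"
  assumes "0 < \<epsilon>"
  shows "J_per \<epsilon> J (z + (2 * pi / \<epsilon>) *\<^sub>R axis k 1) = J_per \<epsilon> J z"
proof -
  have *: "(z $ i + 2 * pi / \<epsilon> + pi / \<epsilon>) / (2 * pi / \<epsilon>) = (z $ i + pi / \<epsilon>) / (2 * pi / \<epsilon>) + 1" for i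
    using assms by (simp add: field_simps)
  have "(z + (2 * pi / \<epsilon>) *\<^sub>R axis k 1) $ i -
      (2 * pi / \<epsilon>) * real_of_int \<lfloor>((z + (2 * pi / \<epsilon>) *\<^sub>R axis k 1) $ i + pi / \<epsilon>) / (2 * pi / \<epsilon>)\<rfloor> =
      z $ i - (2 * pi / \<epsilon>) * real_of_int \<lfloor>(z $ i + pi / \<epsilon>) / (2 * pi / \<epsilon>)\<rfloor>" for i
  proof (cases "i = k")
    case True
    have "(z + (2 * pi / \<epsilon>) *\<^sub>R axis k 1) $ i = z $ i + 2 * pi / \<epsilon>"
      using True by simp
    then show ?thesis
      by (simp only: * floor_add_int[of _ 1, unfolded of_int_1, symmetric] of_int_add of_int_1) (simp add: algebra_simps)
  next
    case False
    then show ?thesis by (simp add: axis_def)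
  qed
  then show ?thesis
    by (simp only: J_per_def)
qed

end

theory Submission
  imports Defs
begin

text \<open>Write the problem as $u_t = F(u)$ in $L^2(\Omega)$, where
  $F(v) = \mathcal{L}_\varepsilon v + f(v)$. The argument rests on three facts: $\Omega$ has finite
  measure $\mu$; the kernel is Borel measurable with $0 \le J_\varepsilon \le B$; and $f$ is Lipschitz with
  some constant $C$ and vanishes at $u_1$ and $u_2$.
  Let $S$ be the set of $v \in L^2(\Omega)$ with values in $\Gamma$ almost
  everywhere, and let $P$ truncate values to $\Gamma$, so that $P v$ is a nearest point of $S$ to $v$.

  Two properties of $F$ carry the proof. First, $F$ is Lipschitz on $L^2(\Omega)$ with constant
  $L = 2B\mu + C$ (\<open>rhs_Lipschitz\<close>). Second, if $h(B\mu + C) \le 1$, the explicit Euler step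
  $v \mapsto v + hF(v)$ maps $S$ into itself (\<open>Euler_step_invariant\<close>): for $v \in S$ both
  $\mathcal{L}_\varepsilon v(x)$ and $f(v(x))$ point into $\Gamma$ at its end points, and their
  outward parts are at most $B\mu$ and $C$ times the distance of $v(x)$ to the end point it approaches.

  Let $N(t) = \|u(t) - P u(t)\|$. On $[0,T]$ the solution is Lipschitz in time, so one Euler step from
  $u(t)$ misses $u(t+h)$ by at most $Dh^2$. Comparing $u(t+h)$ with the Euler step from $P u(t)$, which
  lies in $S$, gives $N(t+h) \le (1 + Lh) N(t) + Dh^2$. Since $N(0) = 0$, summing over $n$ steps of
  size $T/n$ yields $N(T) \le D T^2 e^{LT}/n$ for all large $n$, hence $N(T) = 0$
  (\<open>Euler_flow_invariance\<close>). No time derivative of $u$ is needed.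

  The vector-valued integral enters only through its inner products with elements of $L^2(\Omega)$
  (\<open>L2_has_integral_inner\<close>), which are real integrals. Norm estimates for the
  increments of $u$ are recovered by testing against the increment itself
  (\<open>L2_norm_increment_le\<close>).\<close>

section \<open>Square-integrable functions\<close>

lemma L2_measurable: "v \<in> L2 \<Omega> \<Longrightarrow> v \<in> borel_measurable (lebesgue_on \<Omega>)"
  by (simp add: L2_def)

lemma L2_integrable_square: "v \<in> L2 \<Omega> \<Longrightarrow> integrable (lebesgue_on \<Omega>) (\<lambda>x. (v x)\<^sup>2)"
  by (simp add: L2_def)

lemma L2_integrable_mult:
  assumes "v \<in> L2 \<Omega>" "w \<in> L2 \<Omega>"
  shows "integrable (lebesgue_on \<Omega>) (\<lambda>x. v x * w x)"
proof (rule Bochner_Integration.integrable_bound)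
  show "integrable (lebesgue_on \<Omega>) (\<lambda>x. (v x)\<^sup>2 + (w x)\<^sup>2)"
    using assms by (intro Bochner_Integration.integrable_add L2_integrable_square)
  show "(\<lambda>x. v x * w x) \<in> borel_measurable (lebesgue_on \<Omega>)"
    using assms by (intro borel_measurable_times L2_measurable)
  have "\<bar>a * b\<bar> \<le> a\<^sup>2 + b\<^sup>2" for a b :: real
  proof -
    have "2 * (\<bar>a\<bar> * \<bar>b\<bar>) \<le> \<bar>a\<bar>\<^sup>2 + \<bar>b\<bar>\<^sup>2"
      using sum_squares_bound[of "\<bar>a\<bar>" "\<bar>b\<bar>"] by simp
    moreover have "0 \<le> \<bar>a\<bar> * \<bar>b\<bar>"
      by simp
    ultimately show ?thesis
      unfolding abs_mult power2_abs by linarith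
  qed
  then show "AE x in lebesgue_on \<Omega>. norm (v x * w x) \<le> norm ((v x)\<^sup>2 + (w x)\<^sup>2)"
    by (auto intro!: AE_I2)
qed

lemma L2_add:
  assumes "v \<in> L2 \<Omega>" "w \<in> L2 \<Omega>"
  shows "(\<lambda>x. v x + w x) \<in> L2 \<Omega>"
proof -
  have "integrable (lebesgue_on \<Omega>) (\<lambda>x. (v x)\<^sup>2 + (w x)\<^sup>2 + 2 * (v x * w x))"
    using assms by (intro Bochner_Integration.integrable_add L2_integrable_square
        integrable_mult_right L2_integrable_mult)
  then have "integrable (lebesgue_on \<Omega>) (\<lambda>x. (v x + w x)\<^sup>2)"
    by (simp add: power2_sum mult.assoc)
  moreover have "(\<lambda>x. v x + w x) \<in> borel_measurable (lebesgue_on \<Omega>)"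
    using assms by (intro borel_measurable_add L2_measurable)
  ultimately show ?thesis
    by (simp add: L2_def)
qed

lemma L2_cmult: "v \<in> L2 \<Omega> \<Longrightarrow> (\<lambda>x. c * v x) \<in> L2 \<Omega>"
  by (auto simp: L2_def power_mult_distrib)

lemma L2_zero: "(\<lambda>x. 0) \<in> L2 \<Omega>"
  by (simp add: L2_def)

lemma L2_diff:
  assumes "v \<in> L2 \<Omega>" "w \<in> L2 \<Omega>"
  shows "(\<lambda>x. v x - w x) \<in> L2 \<Omega>"
  using L2_add[OF assms(1) L2_cmult[OF assms(2), of "-1"]] by simp

lemma L2_sum:
  assumes "\<And>i. i \<in> I \<Longrightarrow> v i \<in> L2 \<Omega>"
  shows "(\<lambda>x. \<Sum>i\<in>I. v i x) \<in> L2 \<Omega>"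
  using assms by (induction I rule: infinite_finite_induct) (auto intro: L2_zero L2_add)

text \<open>The inner product of $L^2(\Omega)$.\<close>

definition L2_inner :: "(real^'n) set \<Rightarrow> (real^'n \<Rightarrow> real) \<Rightarrow> (real^'n \<Rightarrow> real) \<Rightarrow> real" where
  "L2_inner \<Omega> v w = (\<integral>x. v x * w x \<partial>lebesgue_on \<Omega>)"

lemma L2_inner_add_left:
  assumes "v \<in> L2 \<Omega>" "w \<in> L2 \<Omega>" "\<phi> \<in> L2 \<Omega>"
  shows "L2_inner \<Omega> (\<lambda>x. v x + w x) \<phi> = L2_inner \<Omega> v \<phi> + L2_inner \<Omega> w \<phi>"
  using assms by (simp add: L2_inner_def L2_integrable_mult distrib_right)

lemma L2_inner_cmult_left: "L2_inner \<Omega> (\<lambda>x. c * v x) \<phi> = c * L2_inner \<Omega> v \<phi>"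
  by (simp add: L2_inner_def mult.assoc)

lemma L2_inner_diff_left:
  assumes "v \<in> L2 \<Omega>" "w \<in> L2 \<Omega>" "\<phi> \<in> L2 \<Omega>"
  shows "L2_inner \<Omega> (\<lambda>x. v x - w x) \<phi> = L2_inner \<Omega> v \<phi> - L2_inner \<Omega> w \<phi>"
  using assms by (simp add: L2_inner_def L2_integrable_mult left_diff_distrib)

lemma L2_inner_sum_left:
  assumes "\<And>i. i \<in> I \<Longrightarrow> v i \<in> L2 \<Omega>" "\<phi> \<in> L2 \<Omega>"
  shows "L2_inner \<Omega> (\<lambda>x. \<Sum>i\<in>I. v i x) \<phi> = (\<Sum>i\<in>I. L2_inner \<Omega> (v i) \<phi>)"
  using assms by (simp add: L2_inner_def L2_integrable_mult sum_distrib_right)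

lemma L2_inner_cong_AE:
  assumes "AE x in lebesgue_on \<Omega>. v x = w x"
    and "v \<in> L2 \<Omega>" "w \<in> L2 \<Omega>" "\<phi> \<in> L2 \<Omega>"
  shows "L2_inner \<Omega> v \<phi> = L2_inner \<Omega> w \<phi>"
  unfolding L2_inner_def
proof (rule integral_cong_AE)
  show "(\<lambda>x. v x * \<phi> x) \<in> borel_measurable (lebesgue_on \<Omega>)"
    and "(\<lambda>x. w x * \<phi> x) \<in> borel_measurable (lebesgue_on \<Omega>)"
    using assms by (auto intro: borel_measurable_times L2_measurable)
  show "AE x in lebesgue_on \<Omega>. v x * \<phi> x = w x * \<phi> x"
    using assms(1) by eventually_elim simp
qed

lemma L2_norm_nonneg: "0 \<le> L2_norm \<Omega> v"
  by (simp add: L2_norm_def)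

lemma L2_norm_square: "(L2_norm \<Omega> v)\<^sup>2 = L2_inner \<Omega> v v"
  by (simp add: L2_norm_def L2_inner_def power2_eq_square flip: real_sqrt_mult)

lemma L2_norm_cmult: "L2_norm \<Omega> (\<lambda>x. c * v x) = \<bar>c\<bar> * L2_norm \<Omega> v"
  by (simp add: L2_norm_def power_mult_distrib real_sqrt_mult)

lemma L2_norm_minus_commute: "L2_norm \<Omega> (\<lambda>x. v x - w x) = L2_norm \<Omega> (\<lambda>x. w x - v x)"
  by (simp add: L2_norm_def power2_commute)

lemma L2_norm_eq_0_iff:
  assumes "v \<in> L2 \<Omega>"
  shows "L2_norm \<Omega> v = 0 \<longleftrightarrow> (AE x in lebesgue_on \<Omega>. v x = 0)"
  using integral_nonneg_eq_0_iff_AE[OF L2_integrable_square[OF assms]]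
  by (simp add: L2_norm_def)

lemma L2_norm_mono:
  assumes "w \<in> L2 \<Omega>" "v \<in> borel_measurable (lebesgue_on \<Omega>)"
    and "AE x in lebesgue_on \<Omega>. \<bar>v x\<bar> \<le> \<bar>w x\<bar>"
  shows "v \<in> L2 \<Omega>" and "L2_norm \<Omega> v \<le> L2_norm \<Omega> w"
proof -
  have *: "AE x in lebesgue_on \<Omega>. (v x)\<^sup>2 \<le> (w x)\<^sup>2"
    using assms(3) by eventually_elim (simp add: abs_le_square_iff)
  have "integrable (lebesgue_on \<Omega>) (\<lambda>x. (v x)\<^sup>2)"
    by (rule Bochner_Integration.integrable_bound[OF L2_integrable_square[OF assms(1)]])
      (use assms * in auto)
  then show "v \<in> L2 \<Omega>"
    using assms by (simp add: L2_def)
  then show "L2_norm \<Omega> v \<le> L2_norm \<Omega> w"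
    unfolding L2_norm_def using assms *
    by (intro real_sqrt_le_mono integral_mono_AE L2_integrable_square)
qed

lemma L2_Cauchy_Schwarz:
  assumes "v \<in> L2 \<Omega>" "w \<in> L2 \<Omega>"
  shows "\<bar>L2_inner \<Omega> v w\<bar> \<le> L2_norm \<Omega> v * L2_norm \<Omega> w"
proof -
  let ?a = "L2_inner \<Omega> v v" and ?b = "L2_inner \<Omega> v w" and ?c = "L2_inner \<Omega> w w"
  have comm: "L2_inner \<Omega> w v = ?b"
    by (simp add: L2_inner_def mult.commute)
  \<comment> \<open>The quadratic form $\|sv - tw\|^2$ is nonnegative for all $s$ and $t$.\<close>
  have quad: "0 \<le> s\<^sup>2 * ?a - 2 * s * t * ?b + t\<^sup>2 * ?c" for s t
  proof -
    have "0 \<le> (\<integral>x. (s * v x - t * w x)\<^sup>2 \<partial>lebesgue_on \<Omega>)"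
      by simp
    also have "\<dots> = (\<integral>x. s\<^sup>2 * (v x * v x) - 2 * s * t * (v x * w x) + t\<^sup>2 * (w x * w x) \<partial>lebesgue_on \<Omega>)"
      by (simp add: power2_eq_square algebra_simps)
    also have "\<dots> = s\<^sup>2 * ?a - 2 * s * t * ?b + t\<^sup>2 * ?c"
      using assms by (simp add: L2_inner_def L2_integrable_mult)
    finally show ?thesis .
  qed
  have a: "0 \<le> ?a" and c: "0 \<le> ?c"
    by (simp_all add: L2_inner_def)
  have "?b\<^sup>2 \<le> ?a * ?c"
  proof (cases "?c = 0")
    case True
    have "?b = 0"
    proof (rule ccontr)
      assume b: "?b \<noteq> 0"
      show False
        using quad[of 1 "(?a + 1) / (2 * ?b)"] True b by (simp add: field_simps)
    qed
    with True show ?thesis by simp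
  next
    case False
    with c have c': "0 < ?c" by simp
    have "0 \<le> ?c * (?a * ?c - ?b\<^sup>2)"
      using quad[of ?c ?b] by (simp add: power2_eq_square algebra_simps)
    then have "0 \<le> ?a * ?c - ?b\<^sup>2"
      using c' by (simp add: zero_le_mult_iff)
    then show ?thesis by simp
  qed
  then have "?b\<^sup>2 \<le> (L2_norm \<Omega> v * L2_norm \<Omega> w)\<^sup>2"
    by (simp add: power_mult_distrib L2_norm_square)
  then show ?thesis
    by (rule abs_le_square_iff[THEN iffD2, THEN order_trans]) (simp add: L2_norm_nonneg)
qed

lemma L2_norm_triangle:
  assumes "v \<in> L2 \<Omega>" "w \<in> L2 \<Omega>"
  shows "L2_norm \<Omega> (\<lambda>x. v x + w x) \<le> L2_norm \<Omega> v + L2_norm \<Omega> w"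
proof (rule power2_le_imp_le)
  have "(L2_norm \<Omega> (\<lambda>x. v x + w x))\<^sup>2 =
      (\<integral>x. v x * v x + 2 * (v x * w x) + w x * w x \<partial>lebesgue_on \<Omega>)"
    by (simp add: L2_norm_square L2_inner_def algebra_simps)
  also have "\<dots> = (L2_norm \<Omega> v)\<^sup>2 + 2 * L2_inner \<Omega> v w + (L2_norm \<Omega> w)\<^sup>2"
    using assms by (simp add: L2_norm_square L2_inner_def L2_integrable_mult)
  also have "\<dots> \<le> (L2_norm \<Omega> v + L2_norm \<Omega> w)\<^sup>2"
    using L2_Cauchy_Schwarz[OF assms] by (simp add: power2_sum)
  finally show "(L2_norm \<Omega> (\<lambda>x. v x + w x))\<^sup>2 \<le> (L2_norm \<Omega> v + L2_norm \<Omega> w)\<^sup>2" .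
qed (simp add: L2_norm_nonneg)

lemma L2_norm_diff_triangle:
  assumes "v \<in> L2 \<Omega>" "w \<in> L2 \<Omega>" "z \<in> L2 \<Omega>"
  shows "L2_norm \<Omega> (\<lambda>x. v x - z x) \<le> L2_norm \<Omega> (\<lambda>x. v x - w x) + L2_norm \<Omega> (\<lambda>x. w x - z x)"
  using L2_norm_triangle[OF L2_diff[OF assms(1,2)] L2_diff[OF assms(2,3)]] by simp

section \<open>Weak form of the time integral\<close>

text \<open>Pairing with a fixed $\varphi$ is a bounded linear functional, so it carries the Riemann sums of
  $v$ to those of the real function $s \mapsto \langle v(s), \varphi\rangle$.\<close>

lemma L2_has_integral_inner:
  fixes \<Omega> :: "(real^'n) set"
  assumes "L2_has_integral \<Omega> v I a b" "\<phi> \<in> L2 \<Omega>"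
  shows "((\<lambda>s. L2_inner \<Omega> (v s) \<phi>) has_integral L2_inner \<Omega> I \<phi>) {a..b}"
  unfolding has_integral_real
proof (intro allI impI)
  fix e :: real assume e: "0 < e"
  have v: "v s \<in> L2 \<Omega>" if "s \<in> {a..b}" for s
    using assms that by (simp add: L2_has_integral_def)
  have I: "I \<in> L2 \<Omega>"
    using assms by (simp add: L2_has_integral_def)
  \<comment> \<open>The summand 1 keeps the divisor positive when $\varphi = 0$ almost everywhere.\<close>
  define c where "c = L2_norm \<Omega> \<phi> + 1"
  have c: "0 < c" "L2_norm \<Omega> \<phi> \<le> c"
    using L2_norm_nonneg[of \<Omega> \<phi>] by (auto simp: c_def)
  have "\<forall>e>0. \<exists>\<gamma>. gauge \<gamma> \<and> (\<forall>\<D>. \<D> tagged_division_of {a..b} \<and> \<gamma> fine \<D> \<longrightarrow>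
       L2_norm \<Omega> (\<lambda>x. (\<Sum>(s, K)\<in>\<D>. measure lborel K * v s x) - I x) < e)"
    using assms(1) unfolding L2_has_integral_def by (elim conjE)
  from this[rule_format, OF divide_pos_pos[OF e c(1)]]
  obtain \<gamma> where \<gamma>: "gauge \<gamma>"
    "\<forall>\<D>. \<D> tagged_division_of {a..b} \<and> \<gamma> fine \<D> \<longrightarrow>
       L2_norm \<Omega> (\<lambda>x. (\<Sum>(s, K)\<in>\<D>. measure lborel K * v s x) - I x) < e / c"
    by (elim exE conjE)
  have "norm ((\<Sum>(s, K)\<in>\<D>. measure lborel K *\<^sub>R L2_inner \<Omega> (v s) \<phi>) - L2_inner \<Omega> I \<phi>) < e"
    if \<D>: "\<D> tagged_division_of {a..b}" "\<gamma> fine \<D>" for \<D>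
  proof -
    define w where "w p = (\<lambda>x. measure lborel (snd p) * v (fst p) x)" for p :: "real \<times> real set"
    have w: "w p \<in> L2 \<Omega>" if "p \<in> \<D>" for p
      unfolding w_def using tagged_division_ofD(2,3)[OF \<D>(1), of "fst p" "snd p"] that
      by (intro L2_cmult v) auto
    have less: "L2_norm \<Omega> (\<lambda>x. (\<Sum>p\<in>\<D>. w p x) - I x) < e / c"
      using \<gamma>(2)[rule_format, OF conjI[OF \<D>]] by (simp add: w_def case_prod_beta)
    have "(\<Sum>(s, K)\<in>\<D>. measure lborel K *\<^sub>R L2_inner \<Omega> (v s) \<phi>) - L2_inner \<Omega> I \<phi>
        = L2_inner \<Omega> (\<lambda>x. (\<Sum>p\<in>\<D>. w p x) - I x) \<phi>"
      using w I assms(2)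
      by (simp add: L2_inner_diff_left L2_sum L2_inner_sum_left) 
        (simp add: w_def L2_inner_cmult_left case_prod_beta)
    also have "norm \<dots> \<le> L2_norm \<Omega> (\<lambda>x. (\<Sum>p\<in>\<D>. w p x) - I x) * L2_norm \<Omega> \<phi>"
      using w I assms(2) by (simp add: L2_Cauchy_Schwarz L2_diff L2_sum)
    also have "\<dots> \<le> L2_norm \<Omega> (\<lambda>x. (\<Sum>p\<in>\<D>. w p x) - I x) * c"
      using c by (intro mult_left_mono) (auto simp: L2_norm_nonneg)
    also have "\<dots> < e / c * c"
      using less c(1) by (rule mult_strict_right_mono)
    finally show ?thesis using c(1) by simp
  qed
  then show "\<exists>\<gamma>. gauge \<gamma> \<and> (\<forall>\<D>. \<D> tagged_division_of {a..b} \<and> \<gamma> fine \<D> \<longrightarrow>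
      norm ((\<Sum>(x, k)\<in>\<D>. measure lborel k *\<^sub>R L2_inner \<Omega> (v x) \<phi>) - L2_inner \<Omega> I \<phi>) < e)"
    by (intro exI[of _ \<gamma>] conjI \<gamma>(1) allI impI) (elim conjE)
qed

text \<open>If $d$ is the integral of $v$ over $[s,t]$ in the weak sense and $v$ stays within $\kappa$ of a
  fixed $G$, then $d$ is within $\kappa(t-s)$ of $(t-s)G$. With $G = 0$ this bounds the increment; with
  $G = v(s)$ it bounds the error of an explicit Euler step.\<close>

lemma L2_norm_increment_le:
  assumes "s \<le> t" and d: "d \<in> L2 \<Omega>" and G: "G \<in> L2 \<Omega>"
    and v: "\<And>r. r \<in> {s..t} \<Longrightarrow> v r \<in> L2 \<Omega>"
    and int: "\<And>\<phi>. \<phi> \<in> L2 \<Omega> \<Longrightarrow> ((\<lambda>r. L2_inner \<Omega> (v r) \<phi>) has_integral L2_inner \<Omega> d \<phi>) {s..t}"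
    and bd: "\<And>r. r \<in> {s..t} \<Longrightarrow> L2_norm \<Omega> (\<lambda>x. v r x - G x) \<le> \<kappa>"
  shows "L2_norm \<Omega> (\<lambda>x. d x - (t - s) * G x) \<le> \<kappa> * (t - s)"
proof -
  define D where "D = (\<lambda>x. d x - (t - s) * G x)"
  have D: "D \<in> L2 \<Omega>"
    unfolding D_def by (intro L2_diff L2_cmult d G)
  have \<kappa>: "0 \<le> \<kappa>"
    using bd[of s] assms(1) L2_norm_nonneg[of \<Omega> "\<lambda>x. v s x - G x"] by simp
  \<comment> \<open>Testing with $D$ itself produces $\|D\|^2$.\<close>
  have "((\<lambda>r. L2_inner \<Omega> (v r) D - L2_inner \<Omega> G D) has_integral
      L2_inner \<Omega> d D - (t - s) * L2_inner \<Omega> G D) {s..t}"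
    using has_integral_diff[OF int[OF D] has_integral_const_real[of "L2_inner \<Omega> G D" s t]] assms(1)
    by simp
  also have "L2_inner \<Omega> d D - (t - s) * L2_inner \<Omega> G D = (L2_norm \<Omega> D)\<^sup>2"
    using L2_inner_diff_left[OF d L2_cmult[OF G, of "t - s"] D]
    by (simp add: L2_norm_square L2_inner_cmult_left D_def)
  finally have "norm ((L2_norm \<Omega> D)\<^sup>2) \<le> (\<kappa> * L2_norm \<Omega> D) * measure lborel (cbox s t)"
    unfolding box_real[symmetric]
  proof (rule has_integral_bound[rotated])
    fix r assume "r \<in> cbox s t"
    then have r: "r \<in> {s..t}" by simp
    have "\<bar>L2_inner \<Omega> (v r) D - L2_inner \<Omega> G D\<bar> = \<bar>L2_inner \<Omega> (\<lambda>x. v r x - G x) D\<bar>"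
      using v[OF r] G D by (simp add: L2_inner_diff_left)
    also have "\<dots> \<le> L2_norm \<Omega> (\<lambda>x. v r x - G x) * L2_norm \<Omega> D"
      by (intro L2_Cauchy_Schwarz L2_diff v r G D)
    also have "\<dots> \<le> \<kappa> * L2_norm \<Omega> D"
      by (intro mult_right_mono bd r L2_norm_nonneg)
    finally show "norm (L2_inner \<Omega> (v r) D - L2_inner \<Omega> G D) \<le> \<kappa> * L2_norm \<Omega> D"
      by simp
  qed (simp add: \<kappa> L2_norm_nonneg)
  then have "L2_norm \<Omega> D * L2_norm \<Omega> D \<le> (\<kappa> * (t - s)) * L2_norm \<Omega> D"
    using assms(1) by (simp add: power2_eq_square mult_ac)
  moreover have "0 \<le> \<kappa> * (t - s)"
    using \<kappa> assms(1) by simp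
  ultimately have "L2_norm \<Omega> D \<le> \<kappa> * (t - s)"
    using L2_norm_nonneg[of \<Omega> D] by (cases "L2_norm \<Omega> D = 0") (auto simp: mult_le_cancel_right)
  then show ?thesis by (simp add: D_def)
qed

section \<open>Invariance by the explicit Euler scheme\<close>

lemma discrete_Gronwall_zero:
  fixes N :: "real \<Rightarrow> real"
  assumes "0 \<le> L" "0 \<le> D" "0 < h0" "0 < T" and zero: "N 0 \<le> 0"
    and step: "\<And>t h. 0 \<le> t \<Longrightarrow> 0 < h \<Longrightarrow> h \<le> h0 \<Longrightarrow> t + h \<le> T \<Longrightarrow>
      N (t + h) \<le> (1 + L * h) * N t + D * h\<^sup>2"
  shows "N T \<le> 0"
proof -
  \<comment> \<open>Iterate over $n$ equal steps; $n \ge T/h_0$ makes each of them admissible.\<close>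
  have bound: "N T \<le> (D * T\<^sup>2 * exp (L * T)) * inverse (real n)" if n: "0 < n" "T / h0 \<le> real n" for n
  proof -
    define h where "h = T / real n"
    have h: "0 < h" "h \<le> h0" "real n * h = T"
      using n assms(3,4) by (auto simp: h_def field_simps)
    define q where "q = 1 + L * h"
    have q: "1 \<le> q"
      using assms(1) h(1) by (simp add: q_def)
    have iter: "N (real k * h) \<le> real k * (D * h\<^sup>2) * q ^ k" if "k \<le> n" for k
      using that
    proof (induction k)
      case 0
      then show ?case using zero by simp
    next
      case (Suc k)
      have "real (Suc k) * h \<le> real n * h"
        using Suc.prems h(1) by (intro mult_right_mono) auto
      then have "N (real k * h + h) \<le> q * N (real k * h) + D * h\<^sup>2"
        unfolding q_def using h by (intro step) (auto simp: algebra_simps)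
      also have "\<dots> \<le> q * (real k * (D * h\<^sup>2) * q ^ k) + D * h\<^sup>2 * q ^ Suc k"
      proof (rule add_mono)
        show "q * N (real k * h) \<le> q * (real k * (D * h\<^sup>2) * q ^ k)"
          using Suc q by (intro mult_left_mono) auto
        show "D * h\<^sup>2 \<le> D * h\<^sup>2 * q ^ Suc k"
          using mult_left_mono[OF one_le_power[OF q, of "Suc k"], of "D * h\<^sup>2"] assms(2) by simp
      qed
      also have "\<dots> = real (Suc k) * (D * h\<^sup>2) * q ^ Suc k"
        by (simp add: algebra_simps)
      finally show ?case by (simp add: algebra_simps)
    qed
    have "q ^ n \<le> exp (L * h) ^ n"
      unfolding q_def using assms(1) h(1) by (intro power_mono exp_ge_add_one_self) auto
    also have "\<dots> = exp (L * T)"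
      using h(3) by (metis exp_of_nat_mult mult.left_commute)
    finally have "N T \<le> real n * (D * h\<^sup>2) * exp (L * T)"
      using iter[of n] assms(2) h(3)
      by (smt (verit) mult_left_mono mult_nonneg_nonneg of_nat_0_le_iff order_refl zero_le_power2)
    also have "\<dots> = (D * T\<^sup>2 * exp (L * T)) * inverse (real n)"
      using n by (simp add: h_def power2_eq_square field_simps)
    finally show ?thesis .
  qed
  have "(\<lambda>n. (D * T\<^sup>2 * exp (L * T)) * inverse (real n)) \<longlonglongrightarrow> (D * T\<^sup>2 * exp (L * T)) * 0"
    by (intro tendsto_intros lim_inverse_n)
  moreover have "\<forall>\<^sub>F n in sequentially. T / h0 \<le> real n"
    using filterlim_real_sequentially by (simp add: filterlim_at_top)
  then have "\<forall>\<^sub>F n in sequentially. N T \<le> (D * T\<^sup>2 * exp (L * T)) * inverse (real n)"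
    using eventually_gt_at_top[of 0] by eventually_elim (rule bound)
  ultimately have "N T \<le> (D * T\<^sup>2 * exp (L * T)) * 0"
    by (rule tendsto_lowerbound) simp
  then show ?thesis by simp
qed

lemma C_L2_bounded:
  assumes "u \<in> C_L2 \<Omega>"
  obtains R where "\<And>t. t \<in> {0..T} \<Longrightarrow> L2_norm \<Omega> (u t) \<le> R"
proof -
  have u: "u t \<in> L2 \<Omega>" if "0 \<le> t" for t
    using assms that by (simp add: C_L2_def)
  have "((\<lambda>s. L2_norm \<Omega> (u s)) \<longlongrightarrow> L2_norm \<Omega> (u t)) (at t within {0..T})" if t: "t \<in> {0..T}" for t
  proof (rule Lim_transform_bound[where g = "\<lambda>s. L2_norm \<Omega> (\<lambda>x. u s x - u t x)", THEN Lim_null[THEN iffD2]])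
    have "((\<lambda>s. L2_norm \<Omega> (\<lambda>x. u s x - u t x)) \<longlongrightarrow> 0) (at t within {0..})"
      using assms t by (simp add: C_L2_def)
    then show "((\<lambda>s. L2_norm \<Omega> (\<lambda>x. u s x - u t x)) \<longlongrightarrow> 0) (at t within {0..T})"
      by (rule tendsto_within_subset) auto
    show "\<forall>\<^sub>F s in at t within {0..T}.
        norm (L2_norm \<Omega> (u s) - L2_norm \<Omega> (u t)) \<le> norm (L2_norm \<Omega> (\<lambda>x. u s x - u t x))"
      unfolding eventually_at_filter
    proof (intro always_eventually allI impI)
      fix s assume "s \<in> {0..T}"
      then have s: "u s \<in> L2 \<Omega>" and t': "u t \<in> L2 \<Omega>"
        using t by (auto intro: u)
      show "norm (L2_norm \<Omega> (u s) - L2_norm \<Omega> (u t)) \<le> norm (L2_norm \<Omega> (\<lambda>x. u s x - u t x))"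
        using L2_norm_diff_triangle[OF s t' L2_zero] L2_norm_diff_triangle[OF t' s L2_zero]
          L2_norm_minus_commute[of \<Omega> "u s" "u t"] by simp
    qed
  qed
  then have "continuous_on {0..T} (\<lambda>s. L2_norm \<Omega> (u s))"
    by (simp add: continuous_on_def)
  then have "bounded ((\<lambda>s. L2_norm \<Omega> (u s)) ` {0..T})"
    by (intro compact_imp_bounded compact_continuous_image) auto
  then obtain R where "\<forall>t\<in>{0..T}. norm (L2_norm \<Omega> (u t)) \<le> R"
    by (auto simp: bounded_iff)
  then show ?thesis
    by (intro that[of R]) (auto simp: abs_le_iff)
qed

text \<open>A set $S$ that explicit Euler steps of all small sizes preserve is invariant under the flow of a
  Lipschitz field $F$. The map $P$ selects a nearest point of $S$; the equation $u_t = F(u)$ is assumed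
  in its weak integrated form.\<close>

lemma Euler_flow_invariance:
  fixes F P :: "(real^'n \<Rightarrow> real) \<Rightarrow> real^'n \<Rightarrow> real" and S :: "(real^'n \<Rightarrow> real) set"
  assumes "0 \<le> L" "0 < h0"
    and F: "\<And>v. v \<in> L2 \<Omega> \<Longrightarrow> F v \<in> L2 \<Omega>"
    and Lip: "\<And>v w. v \<in> L2 \<Omega> \<Longrightarrow> w \<in> L2 \<Omega> \<Longrightarrow>
      L2_norm \<Omega> (\<lambda>x. F v x - F w x) \<le> L * L2_norm \<Omega> (\<lambda>x. v x - w x)"
    and S: "S \<subseteq> L2 \<Omega>"
    and P: "\<And>v. v \<in> L2 \<Omega> \<Longrightarrow> P v \<in> S"
    and nearest: "\<And>v w. v \<in> L2 \<Omega> \<Longrightarrow> w \<in> S \<Longrightarrow>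
      L2_norm \<Omega> (\<lambda>x. v x - P v x) \<le> L2_norm \<Omega> (\<lambda>x. v x - w x)"
    and Euler: "\<And>v h. v \<in> S \<Longrightarrow> 0 < h \<Longrightarrow> h \<le> h0 \<Longrightarrow> (\<lambda>x. v x + h * F v x) \<in> S"
    and u: "u \<in> C_L2 \<Omega>"
    and u0: "u0 \<in> S"
    and weak: "\<And>t \<phi>. 0 \<le> t \<Longrightarrow> \<phi> \<in> L2 \<Omega> \<Longrightarrow>
      ((\<lambda>s. L2_inner \<Omega> (F (u s)) \<phi>) has_integral L2_inner \<Omega> (\<lambda>x. u t x - u0 x) \<phi>) {0..t}"
    and "0 < T"
  shows "L2_norm \<Omega> (\<lambda>x. u T x - P (u T) x) = 0"
proof -
  have uL2: "u t \<in> L2 \<Omega>" if "0 \<le> t" for t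
    using u that by (simp add: C_L2_def)
  have u0L2: "u0 \<in> L2 \<Omega>"
    using u0 S by blast
  have PL2: "P v \<in> L2 \<Omega>" if "v \<in> L2 \<Omega>" for v
    using P[OF that] S by blast
  obtain R where R: "\<And>t. t \<in> {0..T} \<Longrightarrow> L2_norm \<Omega> (u t) \<le> R"
    using C_L2_bounded[OF u, of T] by blast
  \<comment> \<open>A bound for the velocity $F(u)$, hence for the Lipschitz constant of $u$ in time.\<close>
  define B where "B = L * R + L2_norm \<Omega> (F (\<lambda>x. 0))"
  have B: "L2_norm \<Omega> (F (u t)) \<le> B" if "t \<in> {0..T}" for t
  proof -
    have t: "u t \<in> L2 \<Omega>"
      using that by (intro uL2) simp
    have "L2_norm \<Omega> (F (u t)) \<le> L2_norm \<Omega> (\<lambda>x. F (u t) x - F (\<lambda>x. 0) x) + L2_norm \<Omega> (F (\<lambda>x. 0))"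
      using L2_norm_diff_triangle[OF F[OF t] F[OF L2_zero] L2_zero] by simp
    also have "\<dots> \<le> B"
      using Lip[OF t L2_zero] mult_left_mono[OF R[OF that] \<open>0 \<le> L\<close>] by (simp add: B_def)
    finally show ?thesis .
  qed
  have B0: "0 \<le> B"
    using B[of 0] \<open>0 < T\<close> L2_norm_nonneg[of \<Omega> "F (u 0)"] by simp
  have weak_on: "((\<lambda>r. L2_inner \<Omega> (F (u r)) \<phi>) has_integral L2_inner \<Omega> (\<lambda>x. u t x - u s x) \<phi>) {s..t}"
    if "0 \<le> s" "s \<le> t" and \<phi>: "\<phi> \<in> L2 \<Omega>" for s t \<phi>
  proof -
    let ?g = "\<lambda>r. L2_inner \<Omega> (F (u r)) \<phi>"
    have t: "(?g has_integral L2_inner \<Omega> (\<lambda>x. u t x - u0 x) \<phi>) {0..t}"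
      and s: "(?g has_integral L2_inner \<Omega> (\<lambda>x. u s x - u0 x) \<phi>) {0..s}"
      using that by (auto intro!: weak)
    have int: "?g integrable_on {s..t}"
      using t that by (intro integrable_subinterval_real[of ?g 0 t s t]) auto
    have "integral {0..s} ?g + integral {s..t} ?g = integral {0..t} ?g"
      using t that by (intro Henstock_Kurzweil_Integration.integral_combine) auto
    then have "integral {s..t} ?g =
        L2_inner \<Omega> (\<lambda>x. u t x - u0 x) \<phi> - L2_inner \<Omega> (\<lambda>x. u s x - u0 x) \<phi>"
      using integral_unique[OF t] integral_unique[OF s] by simp
    also have "\<dots> = L2_inner \<Omega> (\<lambda>x. (u t x - u0 x) - (u s x - u0 x)) \<phi>"
      using that by (intro L2_inner_diff_left[symmetric] L2_diff uL2 u0L2) auto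
    finally show ?thesis
      using integrable_integral[OF int] by simp
  qed
  have Lipschitz: "L2_norm \<Omega> (\<lambda>x. u t x - u s x) \<le> B * (t - s)"
    if "0 \<le> s" "s \<le> t" "t \<le> T" for s t
    using that B
    by (intro L2_norm_increment_le[where G = "\<lambda>x. 0" and v = "\<lambda>r. F (u r)", simplified]
        L2_diff F uL2 L2_zero weak_on) auto
  have consistent: "L2_norm \<Omega> (\<lambda>x. u (t + h) x - (u t x + h * F (u t) x)) \<le> (L * B) * h\<^sup>2"
    if "0 \<le> t" "0 < h" "t + h \<le> T" for t h
  proof -
    have "L2_norm \<Omega> (\<lambda>x. (u (t + h) x - u t x) - (t + h - t) * F (u t) x) \<le> (L * (B * h)) * (t + h - t)"
    proof (rule L2_norm_increment_le[where v = "\<lambda>r. F (u r)"])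
      fix r assume r: "r \<in> {t..t + h}"
      have "L2_norm \<Omega> (\<lambda>x. F (u r) x - F (u t) x) \<le> L * L2_norm \<Omega> (\<lambda>x. u r x - u t x)"
        using r that by (intro Lip uL2) auto
      also have "\<dots> \<le> L * (B * (r - t))"
        using r that by (intro mult_left_mono Lipschitz \<open>0 \<le> L\<close>) auto
      also have "\<dots> \<le> L * (B * h)"
        using r B0 by (intro mult_left_mono \<open>0 \<le> L\<close>) auto
      finally show "L2_norm \<Omega> (\<lambda>x. F (u r) x - F (u t) x) \<le> L * (B * h)" .
    qed (use that in \<open>auto intro!: L2_diff F uL2 weak_on\<close>)
    then show ?thesis by (simp add: power2_eq_square mult_ac diff_diff_eq)
  qed
  define N where "N t = L2_norm \<Omega> (\<lambda>x. u t x - P (u t) x)" for t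
  have "N T \<le> 0"
  proof (rule discrete_Gronwall_zero[where N = N and L = L and D = "L * B" and ?h0.0 = h0])
    have "L2_norm \<Omega> (\<lambda>x. (u 0 x - u0 x) - (0 - 0) * 0) \<le> B * (0 - 0)"
    proof (rule L2_norm_increment_le[where v = "\<lambda>r. F (u r)"])
      show "((\<lambda>r. L2_inner \<Omega> (F (u r)) \<phi>) has_integral L2_inner \<Omega> (\<lambda>x. u 0 x - u0 x) \<phi>) {0..0}"
        if "\<phi> \<in> L2 \<Omega>" for \<phi>
        using that by (rule weak[OF order_refl])
    qed (use B[of 0] \<open>0 < T\<close> in \<open>auto intro!: L2_diff uL2 u0L2 L2_zero F\<close>)
    then show "N 0 \<le> 0"
      using nearest[OF uL2[of 0] u0] by (simp add: N_def)
  next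
    fix t h :: real assume *: "0 \<le> t" "0 < h" "h \<le> h0" "t + h \<le> T"
    let ?p = "P (u t)"
    let ?e = "\<lambda>v x. v x + h * F v x"
    have L2s: "u (t + h) \<in> L2 \<Omega>" "u t \<in> L2 \<Omega>" "?p \<in> L2 \<Omega>"
      using * by (auto intro: uL2 PL2)
    have "N (t + h) \<le> L2_norm \<Omega> (\<lambda>x. u (t + h) x - ?e ?p x)"
      unfolding N_def using * by (intro nearest Euler P L2s) auto
    also have "\<dots> \<le> L2_norm \<Omega> (\<lambda>x. u (t + h) x - ?e (u t) x) + L2_norm \<Omega> (\<lambda>x. ?e (u t) x - ?e ?p x)"
      by (intro L2_norm_diff_triangle L2_add L2_cmult F L2s)
    also have "L2_norm \<Omega> (\<lambda>x. u (t + h) x - ?e (u t) x) \<le> (L * B) * h\<^sup>2"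
      using * by (intro consistent) auto
    also have "L2_norm \<Omega> (\<lambda>x. ?e (u t) x - ?e ?p x) =
        L2_norm \<Omega> (\<lambda>x. (u t x - ?p x) + h * (F (u t) x - F ?p x))"
      by (simp add: algebra_simps)
    also have "\<dots> \<le> N t + L2_norm \<Omega> (\<lambda>x. h * (F (u t) x - F ?p x))"
      unfolding N_def by (intro L2_norm_triangle L2_diff L2_cmult F L2s)
    also have "\<dots> \<le> N t + h * (L * N t)"
      using * Lip[OF L2s(2,3)] by (simp add: L2_norm_cmult N_def)
    finally show "N (t + h) \<le> (1 + L * h) * N t + L * B * h\<^sup>2"
      by (simp add: algebra_simps)
  qed (use assms B0 in auto)
  then show ?thesis
    using L2_norm_nonneg[of \<Omega> "\<lambda>x. u T x - P (u T) x"] by (simp add: N_def)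
qed

section \<open>The right-hand side on a domain of finite measure\<close>

lemma L2_imp_integrable:
  fixes \<Omega> :: "(real^'n) set"
  assumes "\<Omega> \<in> lmeasurable" "v \<in> L2 \<Omega>"
  shows "integrable (lebesgue_on \<Omega>) v"
  by (rule finite_measure.square_integrable_imp_integrable[OF finite_measure_lebesgue_on[OF assms(1)]
        L2_measurable[OF assms(2)] L2_integrable_square[OF assms(2)]])

lemma L2_const:
  fixes \<Omega> :: "(real^'n) set"
  assumes "\<Omega> \<in> lmeasurable"
  shows "(\<lambda>x. c) \<in> L2 \<Omega>" and "L2_norm \<Omega> (\<lambda>x. c) = \<bar>c\<bar> * sqrt (measure lebesgue \<Omega>)"
proof -
  have "measure (lebesgue_on \<Omega>) \<Omega> = measure lebesgue \<Omega>"
    using assms by (intro measure_restrict_space) (auto simp: fmeasurableD)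
  then show "L2_norm \<Omega> (\<lambda>x. c) = \<bar>c\<bar> * sqrt (measure lebesgue \<Omega>)"
    by (simp add: L2_norm_def real_sqrt_mult mult.commute)
  show "(\<lambda>x. c) \<in> L2 \<Omega>"
    using finite_measure_lebesgue_on[OF assms] by (simp add: L2_def finite_measure.integrable_const)
qed

lemma L2_integral_abs_le:
  fixes \<Omega> :: "(real^'n) set"
  assumes "\<Omega> \<in> lmeasurable" "v \<in> L2 \<Omega>"
  shows "(\<integral>x. \<bar>v x\<bar> \<partial>lebesgue_on \<Omega>) \<le> sqrt (measure lebesgue \<Omega>) * L2_norm \<Omega> v"
proof -
  have abs: "(\<lambda>x. \<bar>v x\<bar>) \<in> L2 \<Omega>" "L2_norm \<Omega> (\<lambda>x. \<bar>v x\<bar>) \<le> L2_norm \<Omega> v"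
    using L2_norm_mono[OF assms(2), of "\<lambda>x. \<bar>v x\<bar>"] L2_measurable[OF assms(2)] by auto
  have "(\<integral>x. \<bar>v x\<bar> \<partial>lebesgue_on \<Omega>) = L2_inner \<Omega> (\<lambda>x. 1) (\<lambda>x. \<bar>v x\<bar>)"
    by (simp add: L2_inner_def)
  also have "\<dots> \<le> L2_norm \<Omega> (\<lambda>x. 1) * L2_norm \<Omega> (\<lambda>x. \<bar>v x\<bar>)"
    using L2_Cauchy_Schwarz[OF L2_const(1)[OF assms(1), of 1] abs(1)] by simp
  also have "\<dots> \<le> sqrt (measure lebesgue \<Omega>) * L2_norm \<Omega> v"
    using abs(2) by (simp add: L2_const(2)[OF assms(1)] mult_left_mono)
  finally show ?thesis .
qed

text \<open>The square root is the norm of the constant function 1.\<close>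

lemma L2_affine_bound:
  fixes \<Omega> :: "(real^'n) set"
  assumes \<Omega>: "\<Omega> \<in> lmeasurable" and v: "v \<in> L2 \<Omega>"
    and g: "g \<in> borel_measurable (lebesgue_on \<Omega>)" and "0 \<le> a" "0 \<le> b"
    and le: "\<And>x. \<bar>g x\<bar> \<le> a * \<bar>v x\<bar> + b"
  shows "g \<in> L2 \<Omega>" and "L2_norm \<Omega> g \<le> a * L2_norm \<Omega> v + b * sqrt (measure lebesgue \<Omega>)"
proof -
  have abs: "(\<lambda>x. \<bar>v x\<bar>) \<in> L2 \<Omega>" "L2_norm \<Omega> (\<lambda>x. \<bar>v x\<bar>) \<le> L2_norm \<Omega> v"
    using L2_norm_mono[OF v, of "\<lambda>x. \<bar>v x\<bar>"] L2_measurable[OF v] by auto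
  note dom = L2_add[OF L2_cmult[OF abs(1), of a] L2_const(1)[OF \<Omega>, of b]]
  have AE: "AE x in lebesgue_on \<Omega>. \<bar>g x\<bar> \<le> \<bar>a * \<bar>v x\<bar> + b\<bar>"
    by (intro AE_I2 order_trans[OF le abs_ge_self])
  show "g \<in> L2 \<Omega>"
    by (rule L2_norm_mono(1)[OF dom g AE])
  have "L2_norm \<Omega> g \<le> L2_norm \<Omega> (\<lambda>x. a * \<bar>v x\<bar> + b)"
    by (rule L2_norm_mono(2)[OF dom g AE])
  also have "\<dots> \<le> L2_norm \<Omega> (\<lambda>x. a * \<bar>v x\<bar>) + L2_norm \<Omega> (\<lambda>x. b)"
    by (intro L2_norm_triangle L2_cmult abs L2_const \<Omega>)
  also have "\<dots> \<le> a * L2_norm \<Omega> v + b * sqrt (measure lebesgue \<Omega>)"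
    using abs(2) assms(4,5) by (simp add: L2_norm_cmult L2_const(2)[OF \<Omega>] mult_left_mono)
  finally show "L2_norm \<Omega> g \<le> a * L2_norm \<Omega> v + b * sqrt (measure lebesgue \<Omega>)" .
qed

text \<open>The next results hold for every bounded nonnegative measurable kernel.\<close>

context
  fixes \<Omega> :: "(real^'n) set" and K :: "real^'n \<Rightarrow> real" and B :: real
  assumes \<Omega>: "\<Omega> \<in> lmeasurable"
    and K_measurable: "K \<in> borel_measurable borel"
    and K_nonneg: "\<And>z. 0 \<le> K z" and K_le: "\<And>z. K z \<le> B"
begin

lemma kernel_bound_nonneg: "0 \<le> B"
  using K_nonneg[of 0] K_le[of 0] by linarith

lemma lebesgue_on_borel_measurable_ident: "(\<lambda>x. x) \<in> lebesgue_on \<Omega> \<rightarrow>\<^sub>M borel"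
  using id_borel_measurable_lebesgue_on by (simp add: id_def)

lemma dispersion_measurable:
  assumes "v \<in> borel_measurable (lebesgue_on \<Omega>)"
  shows "dispersion \<Omega> K v \<in> borel_measurable (lebesgue_on \<Omega>)"
proof -
  interpret finite_measure "lebesgue_on \<Omega>"
    by (rule finite_measure_lebesgue_on[OF \<Omega>])
  note [measurable] = assms K_measurable lebesgue_on_borel_measurable_ident
  have "(\<lambda>x. \<integral>y. K (x - y) * (v y - v x) \<partial>lebesgue_on \<Omega>) \<in> borel_measurable (lebesgue_on \<Omega>)"
    by measurable
  then show ?thesis
    by (simp add: dispersion_def[abs_def])
qed

lemma kernel_mult_integrable:
  assumes "integrable (lebesgue_on \<Omega>) w"
  shows "integrable (lebesgue_on \<Omega>) (\<lambda>y. K (x - y) * w y)"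
proof (rule Bochner_Integration.integrable_bound)
  note [measurable] = K_measurable lebesgue_on_borel_measurable_ident
  show "integrable (lebesgue_on \<Omega>) (\<lambda>y. B * w y)"
    using assms by simp
  show "(\<lambda>y. K (x - y) * w y) \<in> borel_measurable (lebesgue_on \<Omega>)"
    using assms[THEN borel_measurable_integrable] by measurable
  show "AE y in lebesgue_on \<Omega>. norm (K (x - y) * w y) \<le> norm (B * w y)"
    using K_nonneg K_le kernel_bound_nonneg by (auto simp: abs_mult intro!: AE_I2 mult_right_mono)
qed

lemma integrable_shift:
  assumes "v \<in> L2 \<Omega>"
  shows "integrable (lebesgue_on \<Omega>) (\<lambda>y. v y - c)"
  using L2_imp_integrable[OF \<Omega> assms] L2_imp_integrable[OF \<Omega> L2_const(1)[OF \<Omega>, of c]] by simp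

lemma integral_const_lebesgue_on: "(\<integral>y. c \<partial>lebesgue_on \<Omega>) = measure lebesgue \<Omega> * c" for c :: real
proof -
  have "measure (lebesgue_on \<Omega>) \<Omega> = measure lebesgue \<Omega>"
    using \<Omega> by (intro measure_restrict_space) (auto simp: fmeasurableD)
  then show ?thesis by simp
qed

lemma abs_dispersion_le:
  assumes "v \<in> L2 \<Omega>"
  shows "\<bar>dispersion \<Omega> K v x\<bar> \<le>
    (B * measure lebesgue \<Omega>) * \<bar>v x\<bar> + B * (\<integral>y. \<bar>v y\<bar> \<partial>lebesgue_on \<Omega>)"
proof -
  note int = L2_imp_integrable[OF \<Omega> assms] L2_imp_integrable[OF \<Omega> L2_const(1)[OF \<Omega>]]
  have "\<bar>dispersion \<Omega> K v x\<bar> \<le> (\<integral>y. B * (\<bar>v y\<bar> + \<bar>v x\<bar>) \<partial>lebesgue_on \<Omega>)"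
    unfolding dispersion_def
  proof (rule integral_abs_bound_integral)
    show "integrable (lebesgue_on \<Omega>) (\<lambda>y. K (x - y) * (v y - v x))"
      by (intro kernel_mult_integrable integrable_shift assms)
    show "integrable (lebesgue_on \<Omega>) (\<lambda>y. B * (\<bar>v y\<bar> + \<bar>v x\<bar>))"
      using int by simp
    show "\<bar>K (x - y) * (v y - v x)\<bar> \<le> B * (\<bar>v y\<bar> + \<bar>v x\<bar>)" for y
      using K_nonneg K_le kernel_bound_nonneg by (auto simp: abs_mult intro!: mult_mono)
  qed
  also have "\<dots> = B * ((\<integral>y. \<bar>v y\<bar> \<partial>lebesgue_on \<Omega>) + (\<integral>y. \<bar>v x\<bar> \<partial>lebesgue_on \<Omega>))"
    using int by (simp del: lebesgue_integral_const)
  also have "\<dots> = (B * measure lebesgue \<Omega>) * \<bar>v x\<bar> + B * (\<integral>y. \<bar>v y\<bar> \<partial>lebesgue_on \<Omega>)"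
    unfolding integral_const_lebesgue_on by (simp add: distrib_left)
  finally show ?thesis .
qed

lemma dispersion_diff:
  assumes "v \<in> L2 \<Omega>" "w \<in> L2 \<Omega>"
  shows "dispersion \<Omega> K v x - dispersion \<Omega> K w x = dispersion \<Omega> K (\<lambda>y. v y - w y) x"
proof -
  have "dispersion \<Omega> K v x - dispersion \<Omega> K w x =
      (\<integral>y. K (x - y) * (v y - v x) - K (x - y) * (w y - w x) \<partial>lebesgue_on \<Omega>)"
    unfolding dispersion_def
    by (intro Bochner_Integration.integral_diff[symmetric] kernel_mult_integrable integrable_shift assms)
  also have "\<dots> = dispersion \<Omega> K (\<lambda>y. v y - w y) x"
    unfolding dispersion_def by (intro arg_cong[where f = "integral\<^sup>L _"] ext) (simp add: right_diff_distrib)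
  finally show ?thesis .
qed

lemma dispersion_L2:
  assumes "v \<in> L2 \<Omega>"
  shows "dispersion \<Omega> K v \<in> L2 \<Omega>"
  by (rule L2_affine_bound(1)[OF \<Omega> assms dispersion_measurable[OF L2_measurable[OF assms]]
        _ _ abs_dispersion_le[OF assms]])
    (auto simp: kernel_bound_nonneg)

lemma reaction_L2:
  assumes "v \<in> L2 \<Omega>" and f: "\<And>a b. \<bar>f a - f b\<bar> \<le> C * \<bar>a - b\<bar>"
  shows "(\<lambda>x. f (v x)) \<in> L2 \<Omega>"
proof -
  have C: "0 \<le> C"
    using order_trans[OF abs_ge_zero f[of 1 0]] by simp
  have "C-lipschitz_on UNIV f"
    using f C by (intro lipschitz_onI) (auto simp: dist_real_def)
  then have "f \<in> borel_measurable borel"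
    by (intro borel_measurable_continuous_onI lipschitz_on_continuous_on)
  then have "(\<lambda>x. f (v x)) \<in> borel_measurable (lebesgue_on \<Omega>)"
    by (rule measurable_compose[OF L2_measurable[OF assms(1)]])
  moreover have "\<bar>f (v x)\<bar> \<le> C * \<bar>v x\<bar> + \<bar>f 0\<bar>" for x
    using f[of "v x" 0] by simp
  ultimately show ?thesis
    by (rule L2_affine_bound(1)[OF \<Omega> assms(1) _ C abs_ge_zero])
qed

lemma rhs_Lipschitz:
  assumes "v \<in> L2 \<Omega>" "w \<in> L2 \<Omega>" and f: "\<And>a b. \<bar>f a - f b\<bar> \<le> C * \<bar>a - b\<bar>"
  shows "L2_norm \<Omega> (\<lambda>x. (dispersion \<Omega> K v x + f (v x)) - (dispersion \<Omega> K w x + f (w x)))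
    \<le> (2 * B * measure lebesgue \<Omega> + C) * L2_norm \<Omega> (\<lambda>x. v x - w x)"
proof -
  let ?d = "\<lambda>x. v x - w x"
  let ?\<mu> = "measure lebesgue \<Omega>"
  let ?I = "\<integral>y. \<bar>?d y\<bar> \<partial>lebesgue_on \<Omega>"
  let ?g = "\<lambda>x. (dispersion \<Omega> K v x + f (v x)) - (dispersion \<Omega> K w x + f (w x))"
  have d: "?d \<in> L2 \<Omega>"
    using assms by (intro L2_diff)
  have C: "0 \<le> C"
    using order_trans[OF abs_ge_zero f[of 1 0]] by simp
  have "L2_norm \<Omega> ?g \<le> (B * ?\<mu> + C) * L2_norm \<Omega> ?d + (B * ?I) * sqrt ?\<mu>"
  proof (rule L2_affine_bound(2)[OF \<Omega> d])
    show "?g \<in> borel_measurable (lebesgue_on \<Omega>)"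
      by (intro L2_measurable L2_diff L2_add dispersion_L2 reaction_L2[of _ f C] assms)
    show "\<bar>?g x\<bar> \<le> (B * ?\<mu> + C) * \<bar>?d x\<bar> + B * ?I" for x
    proof -
      have "?g x = dispersion \<Omega> K ?d x + (f (v x) - f (w x))"
        using dispersion_diff[OF assms(1,2), of x] by simp
      then have "\<bar>?g x\<bar> \<le> \<bar>dispersion \<Omega> K ?d x\<bar> + \<bar>f (v x) - f (w x)\<bar>"
        using abs_triangle_ineq[of "dispersion \<Omega> K ?d x" "f (v x) - f (w x)"] by simp
      also have "\<dots> \<le> (B * ?\<mu> * \<bar>?d x\<bar> + B * ?I) + C * \<bar>?d x\<bar>"
        by (intro add_mono abs_dispersion_le d f)
      finally show ?thesis
        by (simp add: algebra_simps)
    qed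
  qed (auto simp: kernel_bound_nonneg C)
  also have "\<dots> \<le> (B * ?\<mu> + C) * L2_norm \<Omega> ?d + (B * (sqrt ?\<mu> * L2_norm \<Omega> ?d)) * sqrt ?\<mu>"
    by (intro add_left_mono mult_right_mono mult_left_mono L2_integral_abs_le \<Omega> d)
      (auto simp: kernel_bound_nonneg)
  also have "\<dots> = (2 * B * ?\<mu> + C) * L2_norm \<Omega> ?d"
  proof -
    have "(B * (sqrt ?\<mu> * L2_norm \<Omega> ?d)) * sqrt ?\<mu> = B * (sqrt ?\<mu> * sqrt ?\<mu>) * L2_norm \<Omega> ?d"
      by (simp only: mult_ac)
    then show ?thesis by (simp add: algebra_simps)
  qed
  finally show ?thesis .
qed

text \<open>For $v(y) \in [a,b]$ the kernel bounds give
  $B(a - v(x)) \le K(x-y)(v(y) - v(x)) \le B(b - v(x))$, and $f$ obeys the same kind of bounds with $C$ in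
  place of $B$. The condition on $h$ lets the factor $h(B\mu + C)$, where $\mu$ is the measure of $\Omega$,
  be replaced by 1.\<close>

lemma Euler_step_invariant:
  assumes v: "v \<in> L2 \<Omega>" "AE x in lebesgue_on \<Omega>. v x \<in> {a..b}"
    and f: "\<And>a b. \<bar>f a - f b\<bar> \<le> C * \<bar>a - b\<bar>" "f a = 0" "f b = 0"
    and h: "0 < h" "h * (B * measure lebesgue \<Omega> + C) \<le> 1"
  shows "AE x in lebesgue_on \<Omega>. v x + h * (dispersion \<Omega> K v x + f (v x)) \<in> {a..b}"
  using v(2)
proof eventually_elim
  fix x assume x: "v x \<in> {a..b}"
  let ?k = "B * measure lebesgue \<Omega>"
  have int: "integrable (lebesgue_on \<Omega>) (\<lambda>y. K (x - y) * (v y - v x))"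
    by (intro kernel_mult_integrable integrable_shift v)
  have const: "integrable (lebesgue_on \<Omega>) (\<lambda>y. c)" for c :: real
    by (intro L2_imp_integrable L2_const \<Omega>)
  have "?k * (a - v x) = (\<integral>y. B * (a - v x) \<partial>lebesgue_on \<Omega>)"
    by (simp only: integral_const_lebesgue_on mult_ac)
  also have "\<dots> \<le> dispersion \<Omega> K v x"
    unfolding dispersion_def
  proof (rule integral_mono_AE[OF const int])
    show "AE y in lebesgue_on \<Omega>. B * (a - v x) \<le> K (x - y) * (v y - v x)"
      using v(2)
    proof eventually_elim
      fix y assume "v y \<in> {a..b}"
      then have "K (x - y) * (a - v x) \<le> K (x - y) * (v y - v x)"
        by (intro mult_left_mono K_nonneg) auto
      moreover have "B * (a - v x) \<le> K (x - y) * (a - v x)"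
        using x by (intro mult_right_mono_neg K_le) auto
      ultimately show "B * (a - v x) \<le> K (x - y) * (v y - v x)"
        by linarith
    qed
  qed
  finally have lower: "?k * (a - v x) \<le> dispersion \<Omega> K v x" .
  have "dispersion \<Omega> K v x \<le> (\<integral>y. B * (b - v x) \<partial>lebesgue_on \<Omega>)"
    unfolding dispersion_def
  proof (rule integral_mono_AE[OF int const])
    show "AE y in lebesgue_on \<Omega>. K (x - y) * (v y - v x) \<le> B * (b - v x)"
      using v(2)
    proof eventually_elim
      fix y assume "v y \<in> {a..b}"
      then have "K (x - y) * (v y - v x) \<le> K (x - y) * (b - v x)"
        by (intro mult_left_mono K_nonneg) auto
      moreover have "K (x - y) * (b - v x) \<le> B * (b - v x)"
        using x by (intro mult_right_mono K_le) auto
      ultimately show "K (x - y) * (v y - v x) \<le> B * (b - v x)"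
        by linarith
    qed
  qed
  also have "\<dots> = ?k * (b - v x)"
    by (simp only: integral_const_lebesgue_on mult_ac)
  finally have upper: "dispersion \<Omega> K v x \<le> ?k * (b - v x)" .
  have f_bounds: "C * (a - v x) \<le> f (v x)" "f (v x) \<le> C * (b - v x)"
  proof -
    have "\<bar>f (v x)\<bar> \<le> C * (v x - a)" "\<bar>f (v x)\<bar> \<le> C * (b - v x)"
      using f(1)[of "v x" a] f(1)[of "v x" b] f(2,3) x by simp_all
    then show "C * (a - v x) \<le> f (v x)" "f (v x) \<le> C * (b - v x)"
      unfolding abs_le_iff right_diff_distrib by linarith+
  qed
  have "h * ((?k + C) * (a - v x)) \<le> h * (dispersion \<Omega> K v x + f (v x))"
    using lower f_bounds(1) h(1) by (intro mult_left_mono) (auto simp: distrib_right)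
  moreover have "a - v x \<le> h * (?k + C) * (a - v x)"
    using mult_right_mono_neg[OF h(2), of "a - v x"] x by simp
  moreover have "h * (dispersion \<Omega> K v x + f (v x)) \<le> h * ((?k + C) * (b - v x))"
    using upper f_bounds(2) h(1) by (intro mult_left_mono) (auto simp: distrib_right)
  moreover have "h * (?k + C) * (b - v x) \<le> b - v x"
    using mult_right_mono[OF h(2), of "b - v x"] x by simp
  ultimately show "v x + h * (dispersion \<Omega> K v x + f (v x)) \<in> {a..b}"
    by (simp add: mult.assoc)
qed

end

section \<open>The kernel, the domain and the nonlinearity\<close>

lemma dispersal_kernel_bounded:
  fixes J :: "real^'n \<Rightarrow> real"
  assumes "dispersal_kernel J"
  obtains M where "\<And>z. J z \<le> M"
proof -
  have cont: "continuous_on UNIV J" and lim: "(J \<longlongrightarrow> 0) at_infinity"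
    using assms by (auto simp: dispersal_kernel_def)
  have "\<forall>\<^sub>F z in at_infinity. J z < 1"
    using order_tendstoD(2)[OF lim, of 1] by simp
  then obtain R where R: "\<And>z. R \<le> norm z \<Longrightarrow> J z < 1"
    by (auto simp: eventually_at_infinity)
  have "bounded (J ` cball 0 R)"
    by (intro compact_imp_bounded compact_continuous_image continuous_on_subset[OF cont]) auto
  then obtain M where M: "\<forall>z\<in>cball 0 R. norm (J z) \<le> M"
    by (auto simp: bounded_iff)
  have "J z \<le> max M 1" for z
  proof (cases "R \<le> norm z")
    case True
    then show ?thesis using R[of z] by simp
  next
    case False
    then have "norm (J z) \<le> M"
      using M by simp
    then show ?thesis by simp
  qed
  then show ?thesis by (rule that)
qed

lemma dispersal_kernel_measurable:
  "dispersal_kernel J \<Longrightarrow> J \<in> borel_measurable borel"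
  by (simp add: dispersal_kernel_def borel_measurable_continuous_onI)

lemma scaled_kernel_bounded:
  fixes I :: "real^'n \<Rightarrow> real"
  assumes "0 \<le> c" and "\<And>z. 0 \<le> I z" "\<And>z. I z \<le> M" "I \<in> borel_measurable borel"
  shows "(\<lambda>z. c * I (z /\<^sub>R \<epsilon>)) \<in> borel_measurable borel"
    and "0 \<le> c * I (z /\<^sub>R \<epsilon>)" and "c * I (z /\<^sub>R \<epsilon>) \<le> c * M"
proof -
  have [measurable]: "I \<in> borel_measurable borel"
    by fact
  show "(\<lambda>z. c * I (z /\<^sub>R \<epsilon>)) \<in> borel_measurable borel"
    by measurable
  show "0 \<le> c * I (z /\<^sub>R \<epsilon>)" "c * I (z /\<^sub>R \<epsilon>) \<le> c * M"
    using assms by (auto intro!: mult_left_mono)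
qed

text \<open>The periodic extension need not be continuous across the faces of the cells, but it is a
  composition of $J$ with a Borel map.\<close>

lemma J_per_measurable:
  fixes J :: "real^'n \<Rightarrow> real"
  assumes "J \<in> borel_measurable borel"
  shows "J_per \<epsilon> J \<in> borel_measurable borel"
proof -
  have nth [measurable]: "(\<lambda>z::real^'n. z $ i) \<in> borel_measurable borel" for i
    by (intro borel_measurable_continuous_onI continuous_intros)
  have "(\<lambda>z::real^'n. \<chi> i. z $ i - (2 * pi / \<epsilon>) * real_of_int \<lfloor>(z $ i + pi / \<epsilon>) / (2 * pi / \<epsilon>)\<rfloor>)
      \<in> borel \<rightarrow>\<^sub>M borel"
  proof (subst borel_measurable_euclidean_space, intro ballI)
    fix b :: "real^'n" assume "b \<in> Basis"
    then obtain i where b: "b = axis i 1"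
      by (auto simp: Basis_vec_def)
    show "(\<lambda>z::real^'n. (\<chi> i. z $ i - (2 * pi / \<epsilon>) *
        real_of_int \<lfloor>(z $ i + pi / \<epsilon>) / (2 * pi / \<epsilon>)\<rfloor>) \<bullet> b) \<in> borel_measurable borel"
      unfolding b inner_axis by simp
  qed
  from measurable_compose[OF this assms] show ?thesis
    by (simp add: J_per_def[abs_def])
qed

lemma setting_kernel_bounded:
  fixes \<Omega> :: "(real^'n) set" and J J\<epsilon> :: "real^'n \<Rightarrow> real"
  assumes "(open \<Omega> \<and> bounded \<Omega> \<and> normalized_kernel J \<and> J\<epsilon> = J_eps \<epsilon> m J) \<or>
           (\<Omega> = cube pi \<and> dispersal_kernel J \<and> J\<epsilon> = J_eps_per \<epsilon> m J)"
  obtains B where "J\<epsilon> \<in> borel_measurable borel" "\<And>z. 0 \<le> J\<epsilon> z" "\<And>z. J\<epsilon> z \<le> B"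
proof -
  have J: "dispersal_kernel J"
    using assms by (auto simp: normalized_kernel_def)
  then have nonneg: "0 \<le> J z" for z
    by (simp add: dispersal_kernel_def)
  obtain M where M: "\<And>z. J z \<le> M"
    using dispersal_kernel_bounded[OF J] by blast
  obtain c I where cI: "0 \<le> c" "\<And>z. 0 \<le> I z" "\<And>z. I z \<le> M" "I \<in> borel_measurable borel"
    and eq: "J\<epsilon> = (\<lambda>z. c * I (z /\<^sub>R \<epsilon>))"
    using assms
  proof (elim disjE conjE)
    assume "J\<epsilon> = J_eps \<epsilon> m J"
    then show thesis
      using nonneg M dispersal_kernel_measurable[OF J]
      by (intro that[of "C_norm J / \<epsilon> powr (m + real CARD('n))" J])
        (auto simp: J_eps_def C_norm_def)
  next
    assume "J\<epsilon> = J_eps_per \<epsilon> m J"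
    then show thesis
      using nonneg M J_per_measurable[OF dispersal_kernel_measurable[OF J]]
      by (intro that[of "C_norm_per \<epsilon> J / \<epsilon> powr (m + real CARD('n))" "J_per \<epsilon> J"])
        (auto simp: J_eps_per_def C_norm_per_def J_per_def)
  qed
  show ?thesis
    by (rule that[of "c * M"]) (simp_all only: eq scaled_kernel_bounded[OF cI])
qed

lemma setting_domain_lmeasurable:
  fixes \<Omega> :: "(real^'n) set"
  assumes "open \<Omega> \<and> bounded \<Omega> \<or> \<Omega> = cube r"
  shows "\<Omega> \<in> lmeasurable"
proof -
  have "(cube r :: (real^'n) set) = box (\<chi> i. - r) (\<chi> i. r)"
    by (auto simp: cube_def mem_box_cart)
  then have "open (cube r :: (real^'n) set)" "bounded (cube r :: (real^'n) set)"
    by (simp_all only: open_box bounded_box)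
  then show ?thesis
    using assms by (auto intro: lmeasurable_open)
qed

text \<open>An almost everywhere bound on a continuous derivative holds everywhere, because the set where it
  fails is open and null.\<close>

lemma C1_AE_bounded_deriv_imp_Lipschitz:
  fixes f :: "real \<Rightarrow> real"
  assumes "f C1_differentiable_on UNIV" and "AE s in lebesgue. \<bar>deriv f s\<bar> \<le> C"
  shows "\<bar>f a - f b\<bar> \<le> C * \<bar>a - b\<bar>"
proof -
  have diff: "f differentiable at x" for x
    using assms(1) by (simp add: C1_differentiable_on_eq)
  have cont: "continuous_on UNIV (deriv f)"
    using assms(1)
    by (simp add: C1_differentiable_on_eq field_derivative_eq_vector_derivative[abs_def])
  define U where "U = {s. C < \<bar>deriv f s\<bar>}"
  have U: "open U"
    unfolding U_def by (intro open_Collect_less continuous_intros cont)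
  have "U \<in> null_sets lebesgue"
    using assms(2) U by (subst AE_iff_null_sets) (auto simp: U_def not_less)
  then have "U = {}"
    using open_not_negligible[OF U] by (auto simp: negligible_iff_null_sets)
  then have bound: "norm (deriv f s) \<le> C" for s
    by (auto simp: U_def not_less)
  have "(f has_field_derivative deriv f x) (at x within UNIV)" for x
    using diff[of x] by (simp add: DERIV_deriv_iff_real_differentiable)
  from field_differentiable_bound[OF convex_UNIV this bound, of a b] show ?thesis
    by simp
qed

section \<open>The invariant interval\<close>

lemma solution_weak_form:
  fixes \<Omega> :: "(real^'n) set"
  assumes sol: "is_solution \<Omega> K f u0 u" and u: "u \<in> C_L2 \<Omega>" and u0: "u0 \<in> L2 \<Omega>"
    and "0 \<le> t" and \<phi>: "\<phi> \<in> L2 \<Omega>"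
  shows "((\<lambda>s. L2_inner \<Omega> (\<lambda>x. dispersion \<Omega> K (u s) x + f (u s x)) \<phi>) has_integral
    L2_inner \<Omega> (\<lambda>x. u t x - u0 x) \<phi>) {0..t}"
proof -
  obtain I1 I2 where I1: "L2_has_integral \<Omega> (\<lambda>s. dispersion \<Omega> K (u s)) I1 0 t"
    and I2: "L2_has_integral \<Omega> (\<lambda>s x. f (u s x)) I2 0 t"
    and eq: "AE x in lebesgue_on \<Omega>. u t x = u0 x + I1 x + I2 x"
    using sol \<open>0 \<le> t\<close> unfolding is_solution_def by blast
  have L2s: "I1 \<in> L2 \<Omega>" "I2 \<in> L2 \<Omega>" "u t \<in> L2 \<Omega>"
    using I1 I2 u \<open>0 \<le> t\<close> by (auto simp: L2_has_integral_def C_L2_def)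
  have "((\<lambda>s. L2_inner \<Omega> (dispersion \<Omega> K (u s)) \<phi> + L2_inner \<Omega> (\<lambda>x. f (u s x)) \<phi>) has_integral
      L2_inner \<Omega> I1 \<phi> + L2_inner \<Omega> I2 \<phi>) {0..t}"
    by (intro has_integral_add L2_has_integral_inner I1 I2 \<phi>)
  also have "L2_inner \<Omega> I1 \<phi> + L2_inner \<Omega> I2 \<phi> = L2_inner \<Omega> (\<lambda>x. I1 x + I2 x) \<phi>"
    by (intro L2_inner_add_left[symmetric] L2s \<phi>)
  also have "\<dots> = L2_inner \<Omega> (\<lambda>x. u t x - u0 x) \<phi>"
  proof (rule L2_inner_cong_AE)
    show "AE x in lebesgue_on \<Omega>. I1 x + I2 x = u t x - u0 x"
      using eq by eventually_elim simp
  qed (intro L2_add L2_diff L2s u0 \<phi>)+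
  finally show ?thesis
  proof (rule has_integral_eq[rotated])
    fix s assume "s \<in> {0..t}"
    then show "L2_inner \<Omega> (dispersion \<Omega> K (u s)) \<phi> + L2_inner \<Omega> (\<lambda>x. f (u s x)) \<phi> =
        L2_inner \<Omega> (\<lambda>x. dispersion \<Omega> K (u s) x + f (u s x)) \<phi>"
      using I1 I2 \<phi> by (intro L2_inner_add_left[symmetric]) (auto simp: L2_has_integral_def)
  qed
qed

theorem theorem3p2:
  fixes \<Omega> :: "(real^'n) set" and J J\<epsilon> :: "real^'n \<Rightarrow> real" and \<epsilon> m :: real
    and f :: "real \<Rightarrow> real" and u\<^sub>1 u\<^sub>2 :: real
    and u\<^sub>0 :: "real^'n \<Rightarrow> real" and u :: "real \<Rightarrow> real^'n \<Rightarrow> real"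
  assumes "0 < \<epsilon>" and "m \<in> {0..2}"
    and setting: "(open \<Omega> \<and> bounded \<Omega> \<and> normalized_kernel J \<and> J\<epsilon> = J_eps \<epsilon> m J) \<or>
                  (\<Omega> = cube pi \<and> dispersal_kernel J \<and> J\<epsilon> = J_eps_per \<epsilon> m J)"
    and "f C1_differentiable_on UNIV"
    and "\<exists>C. AE s in lebesgue. \<bar>deriv f s\<bar> \<le> C"
    and "u\<^sub>1 < u\<^sub>2" and "f u\<^sub>1 = 0" and "f u\<^sub>2 = 0"
    and "u\<^sub>0 \<in> L2 \<Omega>"
    and "u \<in> C_L2 \<Omega>" and "is_solution \<Omega> J\<epsilon> f u\<^sub>0 u"
    and "AE x in lebesgue_on \<Omega>. u\<^sub>0 x \<in> {u\<^sub>1..u\<^sub>2}"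
  shows "\<forall>t>0. AE x in lebesgue_on \<Omega>. u t x \<in> {u\<^sub>1..u\<^sub>2}"
proof (intro allI impI)
  fix t :: real assume t: "0 < t"
  have \<Omega>: "\<Omega> \<in> lmeasurable"
    using setting by (intro setting_domain_lmeasurable[of _ pi]) auto
  obtain B where K: "J\<epsilon> \<in> borel_measurable borel" "\<And>z. 0 \<le> J\<epsilon> z" "\<And>z. J\<epsilon> z \<le> B"
    using setting_kernel_bounded[OF setting] by blast
  obtain C where f: "\<And>a b. \<bar>f a - f b\<bar> \<le> C * \<bar>a - b\<bar>"
    using assms(5) C1_AE_bounded_deriv_imp_Lipschitz[OF assms(4)] by blast
  have C: "0 \<le> C"
    using order_trans[OF abs_ge_zero f[of 1 0]] by simp
  have B: "0 \<le> B"
    using K(2,3)[of 0] by linarith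
  define \<mu> where "\<mu> = measure lebesgue \<Omega>"
  have \<mu>: "0 \<le> \<mu>"
    by (simp add: \<mu>_def)
  define F where "F v x = dispersion \<Omega> J\<epsilon> v x + f (v x)" for v x
  define P where "P v x = max u\<^sub>1 (min u\<^sub>2 (v x))" for v :: "real^'n \<Rightarrow> real" and x
  define S where "S = {v \<in> L2 \<Omega>. AE x in lebesgue_on \<Omega>. v x \<in> {u\<^sub>1..u\<^sub>2}}"
  \<comment> \<open>The summand 1 covers the case in which $B\mu + C = 0$.\<close>
  define h0 where "h0 = 1 / (B * \<mu> + C + 1)"
  have denom: "0 < B * \<mu> + C + 1"
    using B C \<mu> by (simp add: add_nonneg_pos)
  have P_L2: "P v \<in> L2 \<Omega>" if "v \<in> L2 \<Omega>" for v
  proof (rule L2_affine_bound(1)[OF \<Omega> that])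
    show "P v \<in> borel_measurable (lebesgue_on \<Omega>)"
      using L2_measurable[OF that] unfolding P_def[abs_def] by measurable
    show "\<bar>P v x\<bar> \<le> 1 * \<bar>v x\<bar> + (\<bar>u\<^sub>1\<bar> + \<bar>u\<^sub>2\<bar>)" for x
      unfolding P_def by linarith
  qed auto
  have F_L2: "F v \<in> L2 \<Omega>" if "v \<in> L2 \<Omega>" for v
    unfolding F_def by (intro L2_add dispersion_L2[OF \<Omega> K] reaction_L2[OF \<Omega> K that f] that)
  have "L2_norm \<Omega> (\<lambda>x. u t x - P (u t) x) = 0"
  proof (rule Euler_flow_invariance[where L = "2 * B * \<mu> + C" and ?h0.0 = h0 and F = F and S = S and ?u0.0 = u\<^sub>0])
    show "0 \<le> 2 * B * \<mu> + C" "0 < h0"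
      using B C \<mu> denom by (auto simp: h0_def)
    show "L2_norm \<Omega> (\<lambda>x. F v x - F w x) \<le> (2 * B * \<mu> + C) * L2_norm \<Omega> (\<lambda>x. v x - w x)"
      if "v \<in> L2 \<Omega>" "w \<in> L2 \<Omega>" for v w
      unfolding F_def \<mu>_def by (rule rhs_Lipschitz[OF \<Omega> K that f])
    show "P v \<in> S" if "v \<in> L2 \<Omega>" for v
      using P_L2[OF that] assms(6) by (auto simp: S_def P_def)
    show "L2_norm \<Omega> (\<lambda>x. v x - P v x) \<le> L2_norm \<Omega> (\<lambda>x. v x - w x)" if "v \<in> L2 \<Omega>" "w \<in> S" for v w
    proof (rule L2_norm_mono(2))
      have w: "w \<in> L2 \<Omega>" "AE x in lebesgue_on \<Omega>. w x \<in> {u\<^sub>1..u\<^sub>2}"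
        using that(2) by (auto simp: S_def)
      show "(\<lambda>x. v x - w x) \<in> L2 \<Omega>"
        by (intro L2_diff that w)
      show "(\<lambda>x. v x - P v x) \<in> borel_measurable (lebesgue_on \<Omega>)"
        by (intro L2_measurable L2_diff that P_L2)
      show "AE x in lebesgue_on \<Omega>. \<bar>v x - P v x\<bar> \<le> \<bar>v x - w x\<bar>"
        using w(2) by eventually_elim (auto simp: P_def)
    qed
    show "(\<lambda>x. v x + h * F v x) \<in> S" if "v \<in> S" "0 < h" "h \<le> h0" for v h
    proof -
      have v: "v \<in> L2 \<Omega>" "AE x in lebesgue_on \<Omega>. v x \<in> {u\<^sub>1..u\<^sub>2}"
        using that(1) by (auto simp: S_def)
      have "h * (B * \<mu> + C) \<le> h0 * (B * \<mu> + C + 1)"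
        using that B C \<mu> by (intro mult_mono) auto
      also have "\<dots> = 1"
        using denom by (simp add: h0_def)
      finally have "AE x in lebesgue_on \<Omega>. v x + h * F v x \<in> {u\<^sub>1..u\<^sub>2}"
        unfolding F_def \<mu>_def
        by (intro Euler_step_invariant[OF \<Omega> K v f assms(7,8) that(2)])
      then show ?thesis
        by (simp add: S_def L2_add L2_cmult F_L2 v)
    qed
    show "((\<lambda>s. L2_inner \<Omega> (F (u s)) \<phi>) has_integral L2_inner \<Omega> (\<lambda>x. u r x - u\<^sub>0 x) \<phi>) {0..r}"
      if "0 \<le> r" "\<phi> \<in> L2 \<Omega>" for r \<phi>
      using solution_weak_form[OF assms(11,10,9) that] by (simp add: F_def[abs_def])
    show "u\<^sub>0 \<in> S"
      using assms(9,12) by (simp add: S_def)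
  qed (use F_L2 assms(10) t in \<open>auto simp: S_def\<close>)
  moreover have "u t \<in> L2 \<Omega>"
    using assms(10) t by (simp add: C_L2_def)
  ultimately have "AE x in lebesgue_on \<Omega>. u t x - P (u t) x = 0"
    using L2_norm_eq_0_iff[OF L2_diff[OF _ P_L2]] by blast
  then show "AE x in lebesgue_on \<Omega>. u t x \<in> {u\<^sub>1..u\<^sub>2}"
  proof eventually_elim
    fix x assume "u t x - P (u t) x = 0"
    then show "u t x \<in> {u\<^sub>1..u\<^sub>2}"
      using assms(6) by (auto simp: P_def)
  qed
qed

end
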